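(* Let $\mathcal{L}$ be a closed linear operator with domain $\mathcal{D}(\mathcal{L})$, densely defined on a complex Hilbert space $\mathcal{H}$, and fix $\epsilon>0$. Let $Q:\mathbb{C}^m\rightarrow\mathcal{D}(\mathcal{L})\cap\mathcal{D}(\mathcal{L}^* )$ be a linear map satisfying $Q^*Q=I$, and let ${\rm range}(Q)$ be an $m$-dimensional invariant subspace of $\mathcal{L}$. If the linear map $\hat Q:\mathbb{C}^m\rightarrow\mathcal{D}(\mathcal{L})$ satisfies $$\lVert\hat Q-Q\rVert_{\mathbb{C}^m\rightarrow\mathcal{H}}\left(\lVert\mathcal{L}^*Q\rVert_{\mathbb{C}^m\rightarrow\mathcal{H}}+\lVert\mathcal{L}Q\rVert_{\mathbb{C}^m\rightarrow\mathcal{H}}+\lVert\mathcal{L}(\hat Q-Q)\rVert_{\mathbb{C}^m\rightarrow\mathcal{H}}\right)<\frac{\epsilon}{2},$$ then $\lambda_\epsilon(\hat Q^*\mathcal{L}\hat Q)\subset\lambda_{2\epsilon}(\mathcal{L})$.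
   Context: $\mathcal{L}^*$ with domain $\mathcal{D}(\mathcal{L}^* )$ is the adjoint of $\mathcal{L}$. That ${\rm range}(Q)$ is an invariant subspace of $\mathcal{L}$ means ${\rm range}(Q)\subset\mathcal{D}(\mathcal{L})$ and $\mathcal{L}({\rm range}(Q))\subset{\rm range}(Q)$. $Q^*,\hat Q^*:\mathcal{H}\to\mathbb{C}^m$ are the adjoints of $Q,\hat Q$ viewed as maps $\mathbb{C}^m\to\mathcal{H}$ ($\mathbb{C}^m$ with the standard inner product), so $\hat Q^*\mathcal{L}\hat Q$ is an $m\times m$ matrix, regarded as an operator on the Hilbert space $\mathbb{C}^m$. $\lVert\cdot\rVert_{\mathbb{C}^m\to\mathcal{H}}$ is the operator norm of a linear map from $\mathbb{C}^m$ to $\mathcal{H}$. For $\epsilon>0$ and a closed, densely defined operator $A$ on a Hilbert space $H$ with spectrum $\lambda(A)$, the $\epsilon$-pseudospectrum is $$\lambda_\epsilon(A)=\{z\in\mathbb{C}:\lVert(z\mathcal{I}-A)^{-1}\rVert_H>1/\epsilon\},$$ where $\lVert\cdot\rVert_H$ is the operator norm and, by convention, $\lVert(z\mathcal{I}-A)^{-1}\rVert_H=\infty$ when $z\in\lambda(A)$. *)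

theory Defs
  imports "HOL-Analysis.Analysis"
begin

section \<open>Complex Hilbert spaces\<close>

class scaleC =
  fixes scaleC :: "complex \<Rightarrow> 'a \<Rightarrow> 'a"  (infixr "*\<^sub>C" 75)

class complex_vector = real_vector + scaleC +
  assumes scaleC_add_right: "a *\<^sub>C (x + y) = a *\<^sub>C x + a *\<^sub>C y"
    and scaleC_add_left: "(a + b) *\<^sub>C x = a *\<^sub>C x + b *\<^sub>C x"
    and scaleC_scaleC: "a *\<^sub>C b *\<^sub>C x = (a * b) *\<^sub>C x"
    and scaleC_one: "1 *\<^sub>C x = x"
    and scaleR_scaleC: "r *\<^sub>R x = complex_of_real r *\<^sub>C x"

global_interpretation complex_vector:
    vector_space "scaleC :: complex \<Rightarrow> 'a \<Rightarrow> 'a::complex_vector"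
  by unfold_locales (simp_all add: scaleC_add_right scaleC_add_left scaleC_scaleC scaleC_one)

abbreviation clinear :: "('a::complex_vector \<Rightarrow> 'b::complex_vector) \<Rightarrow> bool"
  where "clinear \<equiv> Vector_Spaces.linear scaleC scaleC"

text \<open>The inner product is conjugate-linear in its first argument.\<close>

class complex_inner = real_normed_vector + complex_vector +
  fixes cinner :: "'a \<Rightarrow> 'a \<Rightarrow> complex"
  assumes cinner_commute: "cinner x y = cnj (cinner y x)"
    and cinner_add_left: "cinner (x + y) z = cinner x z + cinner y z"
    and cinner_scaleC_left: "cinner (c *\<^sub>C x) y = cnj c * cinner x y"
    and cinner_ge_zero: "0 \<le> Re (cinner x x)"
    and cinner_eq_zero_iff: "cinner x x = 0 \<longleftrightarrow> x = 0"
    and norm_eq_sqrt_cinner: "norm x = sqrt (Re (cinner x x))"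

class chilbert_space = complex_inner + complete_space

instantiation complex :: chilbert_space
begin

definition scaleC_complex :: "complex \<Rightarrow> complex \<Rightarrow> complex"
  where "scaleC_complex c x = c * x"

definition cinner_complex :: "complex \<Rightarrow> complex \<Rightarrow> complex"
  where "cinner_complex x y = cnj x * y"

instance
proof
  fix x :: complex
  show "0 \<le> Re (cinner x x)" by (simp add: cinner_complex_def)
  show "norm x = sqrt (Re (cinner x x))"
    by (simp add: cinner_complex_def cmod_def power2_eq_square)
qed (simp_all add: scaleC_complex_def cinner_complex_def scaleR_conv_of_real algebra_simps)

end

instantiation vec :: (complex_vector, finite) complex_vector
begin

definition scaleC_vec :: "complex \<Rightarrow> 'a ^ 'b \<Rightarrow> 'a ^ 'b"
  where "scaleC_vec c x = (\<chi> i. c *\<^sub>C (x $ i))"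

instance
  by standard (simp_all add: scaleC_vec_def vec_eq_iff scaleC_add_right scaleC_add_left
      scaleC_scaleC scaleC_one scaleR_scaleC)

end

instantiation vec :: (complex_inner, finite) complex_inner
begin

definition cinner_vec :: "'a ^ 'b \<Rightarrow> 'a ^ 'b \<Rightarrow> complex"
  where "cinner_vec x y = (\<Sum>i\<in>UNIV. cinner (x $ i) (y $ i))"

instance
proof
  fix x y z :: "'a ^ 'b" and c :: complex
  have sq: "cinner (x $ i) (x $ i) = complex_of_real ((norm (x $ i))\<^sup>2)" for i
  proof (rule complex_eqI)
    show "Re (cinner (x $ i) (x $ i)) = Re (complex_of_real ((norm (x $ i))\<^sup>2))"
      by (simp add: norm_eq_sqrt_cinner cinner_ge_zero)
    have "Im (cinner (x $ i) (x $ i)) = - Im (cinner (x $ i) (x $ i))"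
      by (metis cinner_commute cnj.sel(2))
    then show "Im (cinner (x $ i) (x $ i)) = Im (complex_of_real ((norm (x $ i))\<^sup>2))"
      by simp
  qed
  have s: "cinner x x = complex_of_real ((norm x)\<^sup>2)"
    by (simp add: cinner_vec_def sq norm_vec_def L2_set_def sum_nonneg)
  show "cinner x y = cnj (cinner y x)"
    unfolding cinner_vec_def cnj_sum by (rule sum.cong[OF refl]) (rule cinner_commute)
  show "cinner (x + y) z = cinner x z + cinner y z"
    by (simp add: cinner_vec_def cinner_add_left sum.distrib)
  show "cinner (c *\<^sub>C x) y = cnj c * cinner x y"
    by (simp add: cinner_vec_def scaleC_vec_def cinner_scaleC_left sum_distrib_left)
  show "0 \<le> Re (cinner x x)" unfolding s by simp
  show "cinner x x = 0 \<longleftrightarrow> x = 0" unfolding s by simp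
  show "norm x = sqrt (Re (cinner x x))" unfolding s by simp
qed

end

instance vec :: (chilbert_space, finite) chilbert_space ..


section \<open>Unbounded operators\<close>

text \<open>
  An operator with domain \<open>D\<close> is given by \<open>D\<close> together with a total function \<open>A\<close>, of which
  only the values on \<open>D\<close> are meaningful.
\<close>

definition linear_operator ::
    "'a::complex_vector set \<Rightarrow> ('a \<Rightarrow> 'b::complex_vector) \<Rightarrow> bool" where
  "linear_operator D A \<longleftrightarrow>
     complex_vector.subspace D \<and>
     (\<forall>x\<in>D. \<forall>y\<in>D. A (x + y) = A x + A y) \<and>
     (\<forall>c. \<forall>x\<in>D. A (c *\<^sub>C x) = c *\<^sub>C A x)"

definition closed_operator ::
    "'a::topological_space set \<Rightarrow> ('a \<Rightarrow> 'b::topological_space) \<Rightarrow> bool" where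
  "closed_operator D A \<longleftrightarrow> closed ((\<lambda>x. (x, A x)) ` D)"

definition densely_defined :: "'a::topological_space set \<Rightarrow> bool" where
  "densely_defined D \<longleftrightarrow> closure D = UNIV"

definition adjoint_domain ::
    "'a::chilbert_space set \<Rightarrow> ('a \<Rightarrow> 'b::chilbert_space) \<Rightarrow> 'b set" where
  "adjoint_domain D A = {y. \<exists>w. \<forall>x\<in>D. cinner (A x) y = cinner x w}"

text \<open>
  The representing vector is unique whenever \<open>D\<close> is dense.  With \<open>D = UNIV\<close> this is the adjoint
  of an everywhere defined (bounded) operator.
\<close>

definition adjoint_operator ::
    "'a::chilbert_space set \<Rightarrow> ('a \<Rightarrow> 'b::chilbert_space) \<Rightarrow> 'b \<Rightarrow> 'a" where
  "adjoint_operator D A y = (THE w. \<forall>x\<in>D. cinner (A x) y = cinner x w)"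

definition invariant_subspace ::
    "'a::complex_vector set \<Rightarrow> ('a \<Rightarrow> 'a) \<Rightarrow> 'a set \<Rightarrow> bool" where
  "invariant_subspace D A S \<longleftrightarrow> complex_vector.subspace S \<and> S \<subseteq> D \<and> A ` S \<subseteq> S"

definition resolvent ::
    "'a::complex_vector set \<Rightarrow> ('a \<Rightarrow> 'a) \<Rightarrow> complex \<Rightarrow> 'a \<Rightarrow> 'a" where
  "resolvent D A z = inv_into D (\<lambda>x. z *\<^sub>C x - A x)"

definition resolvent_set ::
    "'a::chilbert_space set \<Rightarrow> ('a \<Rightarrow> 'a) \<Rightarrow> complex set" where
  "resolvent_set D A =
     {z. bij_betw (\<lambda>x. z *\<^sub>C x - A x) D UNIV \<and> bounded_linear (resolvent D A z)}"

definition op_spectrum ::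
    "'a::chilbert_space set \<Rightarrow> ('a \<Rightarrow> 'a) \<Rightarrow> complex set" where
  "op_spectrum D A = - resolvent_set D A"

definition resolvent_norm ::
    "'a::chilbert_space set \<Rightarrow> ('a \<Rightarrow> 'a) \<Rightarrow> complex \<Rightarrow> ereal" where
  "resolvent_norm D A z =
     (if z \<in> op_spectrum D A then \<infinity> else ereal (onorm (resolvent D A z)))"

definition pseudospectrum ::
    "real \<Rightarrow> 'a::chilbert_space set \<Rightarrow> ('a \<Rightarrow> 'a) \<Rightarrow> complex set" where
  "pseudospectrum \<epsilon> D A = {z. resolvent_norm D A z > ereal (1 / \<epsilon>)}"

end

(* A point z lies in the \<epsilon>-pseudospectrum of A as soon as A has an \<epsilon>-pseudomode, that is, a vector u
   with |z u - A u| < \<epsilon> |u|; for matrices the converse holds.  Since range Q is invariant and Q is an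
   isometry, Q maps \<delta>-pseudomodes of Q* L Q to \<delta>-pseudomodes of L.  Finally, with E = Q' - Q,
   Q'* L Q' - Q* L Q = E* L Q + Q* L E + E* L E, and Q* L E is bounded by moving L onto Q, so the two
   matrices differ by less than \<epsilon>/2 and an \<epsilon>-pseudomode of the first is a (3\<epsilon>/2)-pseudomode of the
   second. *)

theory Submission
  imports Defs
begin

section \<open>Complex inner products\<close>

lemma cinner_add_right: "cinner x (y + z) = cinner x y + cinner (x::'a::complex_inner) z"
  by (metis cinner_commute cinner_add_left complex_cnj_add)

lemma cinner_scaleC_right: "cinner x (c *\<^sub>C y) = c * cinner (x::'a::complex_inner) y"
proof -
  have "cinner x (c *\<^sub>C y) = cnj (cnj c * cinner y x)"
    by (metis cinner_commute cinner_scaleC_left)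
  also have "\<dots> = c * cinner x y"
    by (simp add: cinner_commute[of x y])
  finally show ?thesis .
qed

lemma cinner_diff_left: "cinner (x - y) z = cinner x z - cinner (y::'a::complex_inner) z"
  using cinner_add_left[of "x - y" y z] by simp

lemma cinner_diff_right: "cinner x (y - z) = cinner x y - cinner (x::'a::complex_inner) z"
  using cinner_add_right[of x "y - z" z] by simp

lemma cinner_zero_left [simp]: "cinner 0 (z::'a::complex_inner) = 0"
  using cinner_diff_left[of 0 0 z] by simp

lemma cinner_sum_left: "cinner (\<Sum>i\<in>I. f i) z = (\<Sum>i\<in>I. cinner (f i) (z::'a::complex_inner))"
  by (induction I rule: infinite_finite_induct) (simp_all add: cinner_add_left)

lemma Re_cinner_self: "Re (cinner x x) = (norm (x::'a::complex_inner))\<^sup>2"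
  by (simp add: norm_eq_sqrt_cinner cinner_ge_zero)

(* The triangle inequality is part of the class, so Cauchy-Schwarz follows by squaring it. *)
lemma Re_cinner_le: "Re (cinner x y) \<le> norm x * norm (y::'a::complex_inner)"
proof -
  have "(norm (x + y))\<^sup>2 = (norm x)\<^sup>2 + (norm y)\<^sup>2 + 2 * Re (cinner x y)"
    unfolding Re_cinner_self[symmetric] cinner_add_left cinner_add_right
    using cinner_commute[of y x] by simp
  moreover have "(norm (x + y))\<^sup>2 \<le> (norm x + norm y)\<^sup>2"
    by (rule power_mono[OF norm_triangle_ineq norm_ge_zero])
  ultimately show ?thesis
    by (simp add: power2_sum)
qed

text \<open>Density gives some \<open>x\<close> in \<open>D\<close> closer to \<open>d\<close> than
  \<open>norm d\<close>. Since \<open>x\<close> is orthogonal to \<open>d\<close>,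
  \<open>d - x\<close> and \<open>d\<close> have the same inner product with \<open>d\<close>, which
  contradicts Cauchy-Schwarz unless \<open>d = 0\<close>. This gives the uniqueness behind the
  \<open>THE\<close> in \<open>adjoint_operator\<close>.\<close>

lemma eq_zero_if_cinner_zero_dense:
  fixes d :: "'a::chilbert_space"
  assumes "densely_defined D" and orth: "\<And>x. x \<in> D \<Longrightarrow> cinner x d = 0"
  shows "d = 0"
proof (rule ccontr)
  assume "d \<noteq> 0"
  moreover have "d \<in> closure D"
    using assms(1) by (simp add: densely_defined_def)
  ultimately obtain x where x: "x \<in> D" "norm (d - x) < norm d"
    by (metis closure_approachable dist_norm norm_minus_commute zero_less_norm_iff)
  have "(norm d)\<^sup>2 = Re (cinner (d - x) d)"
    using orth[OF x(1)] by (simp add: cinner_diff_left Re_cinner_self)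
  also have "\<dots> \<le> norm (d - x) * norm d"
    by (rule Re_cinner_le)
  also have "\<dots> < norm d * norm d"
    using x \<open>d \<noteq> 0\<close> by simp
  finally show False
    by (simp add: power2_eq_square)
qed

section \<open>Adjoints\<close>

lemma densely_defined_UNIV: "densely_defined UNIV"
  by (simp add: densely_defined_def)

lemma adjoint_operator_eqI:
  assumes "densely_defined D" and w: "\<And>x. x \<in> D \<Longrightarrow> cinner (A x) y = cinner x w"
  shows "adjoint_operator D A y = w"
  unfolding adjoint_operator_def
proof (rule the_equality)
  fix v assume v: "\<forall>x\<in>D. cinner (A x) y = cinner x v"
  have "v - w = 0"
    by (rule eq_zero_if_cinner_zero_dense[OF assms(1)]) (use v w in \<open>simp add: cinner_diff_right\<close>)
  then show "v = w" by simp
qed (use w in blast)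

lemma cinner_adjoint_operator:
  assumes "densely_defined D" "y \<in> adjoint_domain D A" "x \<in> D"
  shows "cinner (A x) y = cinner x (adjoint_operator D A y)"
  using assms adjoint_operator_eqI[OF assms(1)] unfolding adjoint_domain_def by force

lemma adjoint_operator_add:
  assumes "densely_defined D" "y \<in> adjoint_domain D A" "z \<in> adjoint_domain D A"
  shows "adjoint_operator D A (y + z) = adjoint_operator D A y + adjoint_operator D A z"
  using assms by (intro adjoint_operator_eqI) (simp_all add: cinner_add_right cinner_adjoint_operator)

lemma adjoint_operator_scaleC:
  assumes "densely_defined D" "y \<in> adjoint_domain D A"
  shows "adjoint_operator D A (c *\<^sub>C y) = c *\<^sub>C adjoint_operator D A y"
  using assms by (intro adjoint_operator_eqI) (simp_all add: cinner_scaleC_right cinner_adjoint_operator)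

text \<open>Bridges to real linearity, the form in which boundedness on Euclidean spaces and
  \<open>onorm\<close> are available.\<close>

lemma clinear_imp_linear:
  assumes "clinear f" shows "linear f"
proof -
  interpret f: Vector_Spaces.linear scaleC scaleC f by fact
  show ?thesis
    by (rule linearI) (simp_all add: f.add f.scale scaleR_scaleC)
qed

text \<open>On a finite-dimensional source the representing vector is explicit: its coordinates are
  the pairings of \<open>y\<close> with the images of the standard basis.\<close>

lemma adjoint_domain_clinear:
  fixes A :: "complex ^ 'm \<Rightarrow> 'h::chilbert_space"
  assumes "clinear A"
  shows "adjoint_domain UNIV A = UNIV"
proof -
  interpret A: Vector_Spaces.linear scaleC scaleC A by fact
  have "cinner (A x) y = cinner x (\<chi> i. cinner (A (axis i 1)) y)" for x y
  proof -
    have "x = (\<Sum>i\<in>UNIV. x $ i *\<^sub>C axis i 1)"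
      by (simp add: vec_eq_iff scaleC_vec_def scaleC_complex_def axis_def if_distrib cong: if_cong)
    then have "cinner (A x) y = (\<Sum>i\<in>UNIV. cinner (A (x $ i *\<^sub>C axis i 1)) y)"
      by (metis A.sum cinner_sum_left)
    then show ?thesis
      by (simp add: cinner_vec_def A.scale cinner_scaleC_left cinner_complex_def)
  qed
  then show ?thesis
    unfolding adjoint_domain_def by blast
qed

lemma cinner_adjoint_clinear:
  fixes A :: "complex ^ 'm \<Rightarrow> 'h::chilbert_space"
  assumes "clinear A"
  shows "cinner x (adjoint_operator UNIV A y) = cinner (A x) y"
  using cinner_adjoint_operator[OF densely_defined_UNIV, of y A x] adjoint_domain_clinear[OF assms]
  by simp

lemma linear_adjoint_clinear:
  fixes A :: "complex ^ 'm \<Rightarrow> 'h::chilbert_space"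
  assumes "clinear A"
  shows "linear (adjoint_operator UNIV A)"
  by (rule linearI)
    (simp_all add: adjoint_domain_clinear[OF assms] densely_defined_UNIV adjoint_operator_add
      adjoint_operator_scaleC scaleR_scaleC)

section \<open>Operators composed with a map into their domain\<close>

lemma linear_operator_add:
  "linear_operator D A \<Longrightarrow> x \<in> D \<Longrightarrow> y \<in> D \<Longrightarrow> A (x + y) = A x + A y"
  by (simp add: linear_operator_def)

lemma linear_operator_domain_diff:
  "linear_operator D A \<Longrightarrow> x \<in> D \<Longrightarrow> y \<in> D \<Longrightarrow> x - y \<in> D"
  using complex_vector.subspace_diff by (auto simp: linear_operator_def)

text \<open>\<open>A\<close> itself may be unbounded, but its composition with a map from
  \<open>complex ^ 'm\<close> into \<open>D\<close> is linear on a finite-dimensional space, hence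
  bounded. This is what makes the \<open>onorm\<close> terms below genuine bounds.\<close>

lemma linear_comp_linear_operator:
  assumes "linear_operator D A" "linear f" "range f \<subseteq> D"
  shows "linear (\<lambda>x. A (f x))"
  using assms
  by (intro linearI) (auto simp: linear_operator_def linear_add linear_scale scaleR_scaleC image_subset_iff)

lemma linear_adjoint_comp:
  assumes "densely_defined D" "linear f" "range f \<subseteq> adjoint_domain D A"
  shows "linear (\<lambda>x. adjoint_operator D A (f x))"
  using assms
  by (intro linearI) (auto simp: linear_add linear_scale scaleR_scaleC adjoint_operator_add
      adjoint_operator_scaleC image_subset_iff)

lemma norm_le_onorm:
  fixes f :: "'a::euclidean_space \<Rightarrow> 'b::real_normed_vector"
  assumes "linear f"
  shows "norm (f x) \<le> onorm f * norm x"
  using assms by (simp add: onorm linear_conv_bounded_linear)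

lemma norm_clinear_isometry:
  fixes Q :: "complex ^ 'm \<Rightarrow> 'h::chilbert_space"
  assumes "clinear Q" "adjoint_operator UNIV Q \<circ> Q = id"
  shows "norm (Q x) = norm x"
proof -
  have "adjoint_operator UNIV Q (Q x) = x"
    using assms(2) by (metis comp_apply id_apply)
  then have "cinner (Q x) (Q x) = cinner x x"
    using cinner_adjoint_clinear[OF assms(1), of x "Q x"] by simp
  then show ?thesis
    by (simp add: norm_eq_sqrt_cinner)
qed

section \<open>Pseudomodes\<close>

text \<open>The resolvent sends the short vector \<open>z *\<^sub>C x - A x\<close> back to
  \<open>x\<close>, so it stretches some vector by more than 1/\<epsilon>. On the spectrum the
  resolvent norm is infinite by convention.\<close>

lemma pseudomode_imp_pseudospectrum:
  assumes "\<epsilon> > 0" "x \<in> D" and mode: "norm (z *\<^sub>C x - A x) < \<epsilon> * norm x"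
  shows "z \<in> pseudospectrum \<epsilon> D A"
proof (cases "z \<in> resolvent_set D A")
  case True
  define R where "R = resolvent D A z"
  have R: "bounded_linear R" and inj: "inj_on (\<lambda>x. z *\<^sub>C x - A x) D"
    using True by (auto simp: R_def resolvent_set_def bij_betw_def)
  have "R (z *\<^sub>C x - A x) = x"
    unfolding R_def resolvent_def using inv_into_f_f[OF inj assms(2)] .
  then have le: "norm x \<le> onorm R * norm (z *\<^sub>C x - A x)"
    using onorm[OF R] by metis
  have "0 < norm x"
    using le_less_trans[OF norm_ge_zero mode] assms(1) by (simp add: zero_less_mult_iff)
  \<comment> \<open>If \<open>onorm R\<close> vanished, \<open>le\<close> would force
    \<open>x = 0\<close>. Strict positivity keeps \<open>mode\<close> strict after scaling by
    \<open>onorm R\<close>.\<close>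
  then have "0 < onorm R"
    using le onorm_pos_le[OF R] by (cases "onorm R = 0") auto
  then have "onorm R * norm (z *\<^sub>C x - A x) < onorm R * (\<epsilon> * norm x)"
    using mode by simp
  then have "1 * norm x < (onorm R * \<epsilon>) * norm x"
    using le by simp
  then have "1 < onorm R * \<epsilon>"
    using \<open>0 < norm x\<close> mult_less_cancel_right_pos by blast
  then have "1 / \<epsilon> < onorm R"
    using assms(1) by (simp add: field_simps)
  then show ?thesis
    using True by (simp add: pseudospectrum_def resolvent_norm_def op_spectrum_def R_def)
qed (simp add: pseudospectrum_def resolvent_norm_def op_spectrum_def)

text \<open>By contradiction: without a pseudomode, \<open>T\<close> is bounded below by \<epsilon>,
  hence injective, and surjective by finite dimension. Its inverse then has norm at most
  1/\<epsilon>. Strictness of the conclusion already forces \<open>u\<close> to be nonzero.\<close>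

lemma pseudospectrum_imp_pseudomode:
  fixes M :: "complex ^ 'm \<Rightarrow> complex ^ 'm"
  assumes "linear M" "\<epsilon> > 0" and z: "z \<in> pseudospectrum \<epsilon> UNIV M"
  obtains u where "norm (z *\<^sub>C u - M u) < \<epsilon> * norm u"
proof (rule ccontr)
  assume "\<not> thesis"
  define T where "T = (\<lambda>u. z *\<^sub>C u - M u)"
  have below: "\<epsilon> * norm u \<le> norm (T u)" for u
    using that \<open>\<not> thesis\<close> unfolding T_def by (meson not_le)
  have T: "linear T"
    unfolding T_def
  proof (rule linear_compose_sub[OF _ assms(1)])
    show "linear (\<lambda>u. z *\<^sub>C u :: complex ^ 'm)"
      by (rule linearI) (simp_all add: scaleR_scaleC scaleC_add_right mult.commute)
  qed
  have "inj T"
    unfolding linear_injective_0[OF T]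
  proof (intro allI impI)
    fix u assume "T u = 0"
    then have "\<epsilon> * norm u \<le> 0" using below[of u] by simp
    then show "u = 0" using assms(2) by (simp add: mult_le_0_iff)
  qed
  then have "surj T"
    using linear_injective_imp_surjective[OF T] by blast
  then have TR: "T (inv T y) = y" for y
    by (rule surj_f_inv_f)
  have "linear (inv T)"
    using inj_linear_imp_inv_linear[OF T \<open>inj T\<close>] .
  then have bl: "bounded_linear (inv T)"
    by (simp add: linear_conv_bounded_linear)
  have "onorm (inv T) \<le> 1 / \<epsilon>"
  proof (rule onorm_bound)
    show "norm (inv T y) \<le> 1 / \<epsilon> * norm y" for y
      using below[of "inv T y"] assms(2) by (simp add: TR field_simps)
  qed (use assms(2) in simp)
  moreover have "bij T"
    using \<open>inj T\<close> \<open>surj T\<close> by (simp add: bij_def)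
  ultimately show False
    using z bl unfolding T_def
    by (auto simp: pseudospectrum_def resolvent_norm_def op_spectrum_def resolvent_set_def
        resolvent_def)
qed

section \<open>The perturbed compression\<close>

text \<open>Cancels the factor \<open>norm v\<close> at the end of the next estimate; the case
  \<open>a = 0\<close> is where \<open>0 \<le> b\<close> enters.\<close>

lemma le_of_mult_self_le:
  fixes a b :: real
  assumes "0 \<le> a" "a * a \<le> b * a" "0 \<le> b"
  shows "a \<le> b"
  using assms by (cases "a = 0") auto

text \<open>The difference \<open>v\<close> of the two compressions is paired with itself. This
  turns the adjoints of \<open>Q\<close> and \<open>Q'\<close> into \<open>Q v\<close> and
  \<open>Q' v\<close>, and leaves a bound linear in \<open>norm v\<close>.\<close>

lemma norm_compression_diff_le:
  fixes D :: "'h::chilbert_space set" and L :: "'h \<Rightarrow> 'h"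
    and Q Q' :: "complex ^ 'm \<Rightarrow> 'h"
  assumes L: "linear_operator D L" and dense: "densely_defined D"
    and Q: "clinear Q" and ranQ: "range Q \<subseteq> D \<inter> adjoint_domain D L"
    and Q': "clinear Q'" and ranQ': "range Q' \<subseteq> D"
  shows "norm (adjoint_operator UNIV Q' (L (Q' u)) - adjoint_operator UNIV Q (L (Q u)))
    \<le> onorm (\<lambda>x. Q' x - Q x) *
        (onorm (adjoint_operator D L \<circ> Q) + onorm (L \<circ> Q) + onorm (\<lambda>x. L (Q' x - Q x))) * norm u"
    (is "norm ?v \<le> ?e * (?a + ?b + ?c) * _")
proof -
  let ?E = "\<lambda>x. Q' x - Q x"
  have linE: "linear ?E"
    using linear_compose_sub[OF Q'[THEN clinear_imp_linear] Q[THEN clinear_imp_linear]] .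
  have ED: "?E x \<in> D" for x
    using linear_operator_domain_diff[OF L] ranQ ranQ' by blast
  have E: "norm (?E x) \<le> ?e * norm x" for x
    by (rule norm_le_onorm[OF linE])
  have a: "norm (adjoint_operator D L (Q x)) \<le> ?a * norm x" for x
    using norm_le_onorm[OF linear_adjoint_comp[OF dense clinear_imp_linear[OF Q]], of L x] ranQ
    by (simp add: o_def)
  have b: "norm (L (Q x)) \<le> ?b * norm x" for x
    using norm_le_onorm[OF linear_comp_linear_operator[OF L clinear_imp_linear[OF Q]], of x] ranQ
    by (simp add: o_def)
  have c: "norm (L (?E x)) \<le> ?c * norm x" for x
    by (rule norm_le_onorm[OF linear_comp_linear_operator[OF L linE]]) (use ED in blast)
  have e0: "0 \<le> ?e"
    by (rule onorm_pos_le) (simp add: linE linear_linear)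
  have bilinear_le: "Re (cinner x y) \<le> (p * norm v) * (q * norm w)"
    if "norm x \<le> p * norm v" "norm y \<le> q * norm w" for x y :: 'h and v w :: "complex ^ 'm" and p q
    using Re_cinner_le[of x y] mult_mono[OF that] that norm_ge_zero[of x] norm_ge_zero[of y]
    by linarith
  have LQ': "L (Q' u) = L (Q u) + L (?E u)"
    using linear_operator_add[OF L, of "Q u" "?E u"] ED ranQ by auto
  have "Q ?v \<in> adjoint_domain D L"
    using ranQ by blast
  \<comment> \<open>Here \<open>?E u\<close> is estimated without \<open>L\<close>, so the small
    factor \<open>?e\<close> appears in this term too.\<close>
  then have move: "cinner (L (?E u)) (Q ?v) = cinner (?E u) (adjoint_operator D L (Q ?v))"
    by (rule cinner_adjoint_operator[OF dense _ ED])
  have "cinner ?v ?v = cinner (Q' ?v) (L (Q' u)) - cinner (Q ?v) (L (Q u))"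
    by (simp add: cinner_diff_right[of ?v] cinner_adjoint_clinear[OF Q] cinner_adjoint_clinear[OF Q'])
  \<comment> \<open>Both \<open>Q' v\<close> and \<open>L (Q' u)\<close> are split along
    \<open>Q' = Q + E\<close>, and the unperturbed term cancels.\<close>
  also have "\<dots> = cinner (?E ?v) (L (Q u)) + cinner (?E ?v) (L (?E u)) + cinner (Q ?v) (L (?E u))"
    by (simp add: LQ' cinner_diff_left cinner_add_right)
  \<comment> \<open>Only real parts matter, so the arguments of the last product may be swapped, as
    \<open>move\<close> requires.\<close>
  finally have "(norm ?v)\<^sup>2 = Re (cinner (?E ?v) (L (Q u))) + Re (cinner (?E ?v) (L (?E u)))
      + Re (cinner (L (?E u)) (Q ?v))"
    unfolding Re_cinner_self[symmetric] using cinner_commute[of "Q ?v" "L (?E u)"] by simp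
  also have "\<dots> \<le> (?e * norm ?v) * (?b * norm u) + (?e * norm ?v) * (?c * norm u)
      + (?e * norm u) * (?a * norm ?v)"
    unfolding move by (intro add_mono bilinear_le E a b c)
  finally have "norm ?v * norm ?v \<le> (?e * (?a + ?b + ?c) * norm u) * norm ?v"
    by (simp add: power2_eq_square algebra_simps)
  moreover have "0 \<le> ?e * (?a + ?b + ?c) * norm u"
  proof -
    have "0 \<le> ?a"
      by (rule onorm_pos_le)
        (use linear_adjoint_comp[OF dense clinear_imp_linear[OF Q], of L] ranQ
          in \<open>simp add: linear_linear o_def\<close>)
    moreover have "0 \<le> ?b"
      by (rule onorm_pos_le)
        (use linear_comp_linear_operator[OF L clinear_imp_linear[OF Q]] ranQ
          in \<open>simp add: linear_linear o_def\<close>)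
    moreover have "0 \<le> ?c"
      by (rule onorm_pos_le)
        (use linear_comp_linear_operator[OF L linE] ED in \<open>auto simp: linear_linear\<close>)
    ultimately show ?thesis
      using e0 by simp
  qed
  ultimately show ?thesis
    by (rule le_of_mult_self_le[OF norm_ge_zero])
qed

theorem theorem5p2:
  fixes D :: "'h::chilbert_space set" and L :: "'h \<Rightarrow> 'h" and \<epsilon> :: real
    and Q Q' :: "complex ^ 'm \<Rightarrow> 'h"
  assumes "linear_operator D L" and "closed_operator D L" and "densely_defined D"
    and "\<epsilon> > 0"
    and "clinear Q" and "range Q \<subseteq> D \<inter> adjoint_domain D L"
    and "adjoint_operator UNIV Q \<circ> Q = id"
    and "complex_vector.dim (range Q) = CARD('m)"
    and "invariant_subspace D L (range Q)"
    and "clinear Q'" and "range Q' \<subseteq> D"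
    and "onorm (\<lambda>x. Q' x - Q x) *
           (onorm (adjoint_operator D L \<circ> Q) + onorm (L \<circ> Q) + onorm (\<lambda>x. L (Q' x - Q x)))
         < \<epsilon> / 2"
  shows "pseudospectrum \<epsilon> UNIV (adjoint_operator UNIV Q' \<circ> L \<circ> Q') \<subseteq> pseudospectrum (2 * \<epsilon>) D L"
proof
  let ?M = "adjoint_operator UNIV Q' \<circ> L \<circ> Q'"
  fix z assume z: "z \<in> pseudospectrum \<epsilon> UNIV ?M"
  interpret Q: Vector_Spaces.linear scaleC scaleC Q by fact
  have "linear ?M"
    using linear_compose[OF linear_comp_linear_operator[OF assms(1) clinear_imp_linear[OF assms(10)] assms(11)]
        linear_adjoint_clinear[OF assms(10)]]
    by (simp add: o_def)
  then obtain u where u: "norm (z *\<^sub>C u - ?M u) < \<epsilon> * norm u"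
    using pseudospectrum_imp_pseudomode[OF _ assms(4) z] by blast
  \<comment> \<open>Invariance yields \<open>w\<close> with \<open>L (Q u) = Q w\<close>; as
    \<open>Q\<close> is inverted by its adjoint, \<open>w\<close> is the value at \<open>u\<close>
    of the unperturbed compression.\<close>
  have "L (Q u) \<in> range Q"
    using assms(9) by (auto simp: invariant_subspace_def)
  then obtain w where w: "L (Q u) = Q w" by blast
  have QQ: "adjoint_operator UNIV Q (Q x) = x" for x
    using assms(7) by (metis comp_apply id_apply)
  have "norm (?M u - w) \<le> \<epsilon> / 2 * norm u"
    using norm_compression_diff_le[OF assms(1,3,5,6,10,11), of u]
      mult_right_mono[OF less_imp_le[OF assms(12)] norm_ge_zero[of u]]
    by (simp add: w QQ)
  moreover have "z *\<^sub>C Q u - L (Q u) = Q (z *\<^sub>C u - w)"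
    by (simp add: w Q.diff Q.scale)
  \<comment> \<open>The isometry \<open>Q\<close> carries the defect back to
    \<open>complex ^ 'm\<close>, where the pseudomode error and the compression error add up to less
    than 3/2 \<epsilon> times \<open>norm u\<close>.\<close>
  then have "norm (z *\<^sub>C Q u - L (Q u)) = norm ((z *\<^sub>C u - ?M u) + (?M u - w))"
    by (simp add: norm_clinear_isometry[OF assms(5,7)])
  moreover have "0 \<le> \<epsilon> * norm u"
    using assms(4) by simp
  ultimately have "norm (z *\<^sub>C Q u - L (Q u)) < 2 * \<epsilon> * norm (Q u)"
    using u norm_triangle_ineq[of "z *\<^sub>C u - ?M u" "?M u - w"]
    by (simp only: norm_clinear_isometry[OF assms(5,7)])
  then show "z \<in> pseudospectrum (2 * \<epsilon>) D L"
    using assms(4,6) by (intro pseudomode_imp_pseudospectrum) auto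
qed

end
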